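(* For each positive integer $r$ there is a constant $c_r$ such that the following holds. Let $\mathcal{H}_r = \{C_3, C_5, \ldots, C_{2r+1}\}$ be the set of odd cycles of length at most $2r+1$. Then for all positive integers $n,k$, $$h(n, k, \mathcal{H}_r) < c_r\frac{n^2}{k^{r+1}}.$$
   Context: All graphs are finite, undirected and simple. For a family $\mathcal{H}$ of graphs, a graph is $\mathcal{H}$-free if it contains no member of $\mathcal{H}$ as a (not necessarily induced) subgraph. For a graph $G$ and a positive integer $k$, $h(G,k)$ is the minimum number of edges that can be deleted from $G$ so that the remaining graph is $k$-colorable. For positive integers $n,k$, $h(n,k,\mathcal{H})$ is the maximum of $h(G,k)$ over all $\mathcal{H}$-free graphs $G$ on $n$ vertices. $C_\ell$ is the cycle of length $\ell$. *)

theory Defs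
  imports Complex_Main
begin

datatype 'a ugraph = UGraph (verts: "'a set") (edges: "'a set set")

definition simple_graph :: "'a ugraph \<Rightarrow> bool" where
  "simple_graph G \<longleftrightarrow>
     finite (verts G) \<and> (\<forall>e \<in> edges G. e \<subseteq> verts G \<and> card e = 2)"

definition contains_subgraph :: "'a ugraph \<Rightarrow> 'b ugraph \<Rightarrow> bool" where
  "contains_subgraph G H \<longleftrightarrow>
     (\<exists>f. inj_on f (verts H) \<and> f ` verts H \<subseteq> verts G \<and> (\<forall>e \<in> edges H. f ` e \<in> edges G))"

definition family_free :: "'b ugraph set \<Rightarrow> 'a ugraph \<Rightarrow> bool" where
  "family_free \<H> G \<longleftrightarrow> (\<forall>H \<in> \<H>. \<not> contains_subgraph G H)"

definition colorable :: "nat \<Rightarrow> 'a ugraph \<Rightarrow> bool" where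
  "colorable k G \<longleftrightarrow>
     (\<exists>c :: 'a \<Rightarrow> nat. (\<forall>v \<in> verts G. c v < k) \<and>
        (\<forall>u v. {u, v} \<in> edges G \<longrightarrow> c u \<noteq> c v))"

definition delete_edges :: "'a ugraph \<Rightarrow> 'a set set \<Rightarrow> 'a ugraph" where
  "delete_edges G F = UGraph (verts G) (edges G - F)"

definition h_graph :: "'a ugraph \<Rightarrow> nat \<Rightarrow> nat" where
  "h_graph G k = Min {card F | F. F \<subseteq> edges G \<and> colorable k (delete_edges G F)}"

(* Up to isomorphism every finite graph has its vertices among the natural numbers. *)
definition h_family :: "nat \<Rightarrow> nat \<Rightarrow> 'b ugraph set \<Rightarrow> nat" where
  "h_family n k \<H> =
     Max {h_graph G k | G :: nat ugraph.
            simple_graph G \<and> card (verts G) = n \<and> family_free \<H> G}"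

(* The cycle of length l; meaningful only for l >= 3. *)
definition cycle_graph :: "nat \<Rightarrow> nat ugraph" where
  "cycle_graph l = UGraph {..<l} {{i, Suc i mod l} | i. i < l}"

definition short_odd_cycles :: "nat \<Rightarrow> nat ugraph set" where
  "short_odd_cycles r = {cycle_graph (2 * i + 1) | i. 1 \<le> i \<and> i \<le> r}"

(* The minimum in h_graph and the maximum in h_family range over finite nonempty sets
   (for k >= 1 and the families considered here), so neither is a junk value. *)

lemma simple_graph_edges:
  assumes "simple_graph G"
  shows "finite (edges G)" and "card (edges G) \<le> 2 ^ card (verts G)"
proof -
  have f: "finite (verts G)" and s: "edges G \<subseteq> Pow (verts G)"
    using assms by (auto simp: simple_graph_def)
  then show "finite (edges G)" by (meson finite_Pow_iff finite_subset)
  show "card (edges G) \<le> 2 ^ card (verts G)"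
    using card_mono[OF _ s] f by (simp add: card_Pow)
qed

lemma h_graph_set:
  assumes "simple_graph G" "k \<ge> 1"
  shows "finite {card F | F. F \<subseteq> edges G \<and> colorable k (delete_edges G F)}"
    and "card (edges G) \<in> {card F | F. F \<subseteq> edges G \<and> colorable k (delete_edges G F)}"
proof -
  have "{card F | F. F \<subseteq> edges G \<and> colorable k (delete_edges G F)} \<subseteq> card ` Pow (edges G)"
    by auto
  then show "finite {card F | F. F \<subseteq> edges G \<and> colorable k (delete_edges G F)}"
    using simple_graph_edges(1)[OF assms(1)] by (meson finite_Pow_iff finite_imageI finite_subset)
  have "colorable k (delete_edges G (edges G))"
    using assms(2) by (auto simp: colorable_def delete_edges_def intro!: exI[of _ "\<lambda>_. 0"])
  then show "card (edges G) \<in> {card F | F. F \<subseteq> edges G \<and> colorable k (delete_edges G F)}"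
    by blast
qed

lemma h_family_set_finite:
  assumes "k \<ge> 1"
  shows "finite {h_graph G k | G :: nat ugraph.
            simple_graph G \<and> card (verts G) = n \<and> family_free \<H> G}"
proof -
  have "h_graph G k \<le> 2 ^ n" if "simple_graph G" "card (verts G) = n" for G :: "nat ugraph"
    using Min_le[OF h_graph_set[OF that(1) assms]] simple_graph_edges(2)[OF that(1)] that(2)
    unfolding h_graph_def by (simp add: order_trans)
  then have "{h_graph G k | G :: nat ugraph.
            simple_graph G \<and> card (verts G) = n \<and> family_free \<H> G} \<subseteq> {..2 ^ n}"
    by auto
  then show ?thesis using finite_subset by blast
qed

lemma h_family_set_nonempty:
  "{h_graph G k | G :: nat ugraph.
      simple_graph G \<and> card (verts G) = n \<and> family_free (short_odd_cycles r) G} \<noteq> {}"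
proof -
  let ?G = "UGraph {..<n} {}"
  have "edges (cycle_graph (2 * i + 1)) \<noteq> {}" for i
    by (auto simp: cycle_graph_def)
  then have "family_free (short_odd_cycles r) ?G"
    by (fastforce simp: family_free_def short_odd_cycles_def contains_subgraph_def)
  moreover have "simple_graph ?G" "card (verts ?G) = n"
    by (auto simp: simple_graph_def)
  ultimately show ?thesis by blast
qed

lemma simple_cycle_graph:
  assumes "l \<ge> 3"
  shows "simple_graph (cycle_graph l)"
proof -
  have "card {i, Suc i mod l} = 2" if "i < l" for i
  proof -
    have "Suc i mod l \<noteq> i"
      using that assms by (cases "Suc i = l") auto
    then show ?thesis by auto
  qed
  then show ?thesis using assms by (auto simp: simple_graph_def cycle_graph_def)
qed

end

theory Submission imports Defs begin

text \<open>
  If \<open>G\<close> has no short odd cycle, the set \<open>W i\<close> of endpoints of walks of length \<open>i \<le> r\<close> from a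
  vertex is independent, since an edge inside it closes an odd walk of length \<open>2 i + 1\<close>. The
  neighbourhood of \<open>W i\<close> is \<open>W (i + 1)\<close>, so in a set of \<open>u\<close> vertices, around a vertex of degree more
  than \<open>u / q ^ r\<close>, some \<open>W i\<close> with \<open>1 \<le> i \<le> r\<close> expands by a factor of at most \<open>q\<close>. Repeatedly
  removing such a set with its neighbourhood yields one colour class \<open>I\<close>, with at most \<open>q |I|\<close>
  vertices wasted, and a rest \<open>A\<close> of maximum degree at most \<open>u / q ^ r\<close>. After \<open>2 (q + 1)\<close> such
  rounds all but \<open>u / 2\<close> vertices are coloured or lie in such an \<open>A\<close>, which \<open>q\<close> further colours
  handle greedily at cost \<open>u\<^sup>2 / q ^ (r + 1)\<close>. Taking \<open>q\<close> to be a small fraction of \<open>k\<close> and recursing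
  on the other vertices with the remaining colours gives a convergent geometric sum.
\<close>

section \<open>Walks and short odd cycles\<close>

text \<open>As a relation, \<open>^^\<close> yields walks and the relational image yields
  neighbourhoods. The parameter \<open>V\<close> stands for passing to an induced subgraph, so that
  \<open>G\<close> stays fixed while vertices are removed.\<close>

definition adj :: "'a ugraph \<Rightarrow> 'a set \<Rightarrow> 'a rel" where
  "adj G V = {(x, y). x \<in> V \<and> y \<in> V \<and> {x, y} \<in> edges G}"

lemma sym_adj: "sym (adj G V)"
  by (auto simp: sym_def adj_def insert_commute)

lemma relpow_adj_sym: "(x, y) \<in> adj G V ^^ n \<Longrightarrow> (y, x) \<in> adj G V ^^ n"
proof (induction n arbitrary: y)
  case (Suc n)
  then obtain z where "(z, x) \<in> adj G V ^^ n" "(y, z) \<in> adj G V"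
    by (auto dest: symD[OF sym_adj])
  then show ?case by (rule relpow_Suc_I2[rotated])
qed simp

lemma finite_adj_Image: "finite V \<Longrightarrow> finite (adj G V `` X)"
  by (rule finite_subset[of _ V]) (auto simp: adj_def)

lemma simple_graph_no_loop: "simple_graph G \<Longrightarrow> {x} \<notin> edges G"
  by (force simp: simple_graph_def)

text \<open>A repeated vertex splits a closed walk into two shorter closed ones, and if the total
  length is odd then so is one of the two. Hence a shortest odd closed walk is a cycle, of length at
  most \<open>L\<close>.\<close>

lemma no_short_odd_closed_walk:
  assumes G: "simple_graph G" and free: "family_free (short_odd_cycles r) G"
    and walk: "(v, v) \<in> adj G V ^^ L" and L: "odd L" "L \<le> 2 * r + 1"
  shows False
proof -
  \<comment> \<open>The base point is quantified inside \<open>P\<close>, so minimality also applies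
    to the closed segment that starts at \<open>f i\<close>.\<close>
  define P where "P l \<longleftrightarrow> odd l \<and> (\<exists>w. (w, w) \<in> adj G V ^^ l)" for l
  define l where "l = (LEAST l. P l)"
  have "P L" using walk L by (auto simp: P_def)
  then have "P l" and le: "l \<le> L" and least: "\<And>m. P m \<Longrightarrow> l \<le> m"
    unfolding l_def by (auto intro: LeastI Least_le)
  then obtain w where odd: "odd l" and w: "(w, w) \<in> adj G V ^^ l" by (auto simp: P_def)
  from w obtain f where f: "f 0 = w" "f l = w" "\<And>i. i < l \<Longrightarrow> (f i, f (Suc i)) \<in> adj G V"
    unfolding relpow_fun_conv by auto
  have seg: "(f i, f j) \<in> adj G V ^^ (j - i)" if "i \<le> j" "j \<le> l" for i j
    unfolding relpow_fun_conv using that f(3)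
    by (intro exI[of _ "\<lambda>t. f (i + t)"]) auto
  have neq: "f i \<noteq> f j" if ij: "i < j" "j < l" for i j
  proof
    assume eq: "f i = f j"
    \<comment> \<open>The part of the walk between positions \<open>i\<close> and \<open>j\<close>
      is cut out, and the two ends are glued at \<open>f i = f j\<close>.\<close>
    have "(f 0, f l) \<in> adj G V ^^ (i + (l - j))"
      unfolding relpow_add using seg[of 0 i] seg[of j l] ij eq by auto
    then have "\<not> P (i + (l - j)) \<Longrightarrow> \<not> odd (i + (l - j))" using f(1,2) unfolding P_def by metis
    then have "\<not> odd (i + (l - j))" using least[of "i + (l - j)"] ij by linarith
    moreover have "\<not> P (j - i) \<Longrightarrow> \<not> odd (j - i)"
      using seg[of i j] ij eq unfolding P_def by (metis less_imp_le)
    then have "\<not> odd (j - i)" using least[of "j - i"] ij by linarith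
    moreover have "i + (l - j) + (j - i) = l" using ij by simp
    ultimately show False using odd by (metis even_add)
  qed
  \<comment> \<open>A closed walk of length 1 would be a loop; as \<open>l\<close> is odd, it is at
    least 3.\<close>
  have "l \<noteq> 1"
    using w simple_graph_no_loop[OF G, of w] by (auto simp: adj_def)
  then obtain i where i: "l = 2 * i + 1" "1 \<le> i" using odd
    by (metis One_nat_def add_0 less_one mult_0_right not_le oddE)
  have "contains_subgraph G (cycle_graph l)"
    unfolding contains_subgraph_def
  proof (intro exI[of _ f] conjI ballI)
    show "inj_on f (verts (cycle_graph l))"
      unfolding cycle_graph_def inj_on_def ugraph.sel using neq
      by (metis lessThan_iff linorder_neqE_nat)
    have "f i \<in> verts G" if "i < l" for i
      using f(3)[OF that] G by (auto simp: adj_def simple_graph_def)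
    then show "f ` verts (cycle_graph l) \<subseteq> verts G" by (auto simp: cycle_graph_def)
    fix e assume "e \<in> edges (cycle_graph l)"
    then obtain j where j: "j < l" "e = {j, Suc j mod l}" by (auto simp: cycle_graph_def)
    have "f (Suc j mod l) = f (Suc j)" using j f by (cases "Suc j = l") auto
    then show "f ` e \<in> edges G" using f(3)[OF j(1)] j by (auto simp: adj_def)
  qed
  moreover have "cycle_graph l \<in> short_odd_cycles r"
    using i le L by (auto simp: short_odd_cycles_def)
  ultimately show False using free by (auto simp: family_free_def)
qed

lemma walk_sphere_independent:
  assumes G: "simple_graph G" "family_free (short_odd_cycles r) G"
    and i: "i \<le> r" and xy: "(v, x) \<in> adj G V ^^ i" "(v, y) \<in> adj G V ^^ i"
  shows "(x, y) \<notin> adj G V"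
proof
  assume "(x, y) \<in> adj G V"
  then have "(v, y) \<in> adj G V ^^ (i + 1)" using xy by auto
  moreover have "(y, v) \<in> adj G V ^^ i"
    using xy(2) by (rule relpow_adj_sym)
  ultimately have "(v, v) \<in> adj G V ^^ (i + 1 + i)" unfolding relpow_add by blast
  then show False using no_short_odd_closed_walk[OF G, where L = "i + 1 + i"] i by fastforce
qed

section \<open>Independent sets with small neighbourhoods\<close>

text \<open>If all of \<open>W 1\<close>, ..., \<open>W r\<close> expanded by a factor above
  \<open>q\<close>, then starting from more than \<open>D\<close> vertices in \<open>W 1\<close> the
  set \<open>W (r + 1)\<close> would have more than \<open>D * q ^ r\<close> vertices, too many for
  \<open>V\<close>.\<close>

lemma slowly_expanding_independent_set:
  fixes D :: real and q :: nat
  assumes G: "simple_graph G" "family_free (short_odd_cycles r) G"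
    and V: "finite V" "real (card V) \<le> D * real q ^ r" and D: "0 \<le> D"
    and v: "D < card (adj G V `` {v})"
  obtains I where "I \<subseteq> V" "I \<noteq> {}" "I \<inter> adj G V `` I = {}"
    "card (adj G V `` I) \<le> q * card I"
proof -
  define W where "W i = (adj G V ^^ i) `` {v}" for i
  have W_Suc: "W (Suc i) = adj G V `` W i" for i by (auto simp: W_def)
  have WV: "W (Suc i) \<subseteq> V" for i unfolding W_Suc by (auto simp: adj_def)
  have indep: "W i \<inter> adj G V `` W i = {}" if "i \<le> r" for i
    using walk_sphere_independent[OF G that] by (fastforce simp: W_def)
  have "\<exists>i<r. W (Suc i) \<noteq> {} \<and> card (W (Suc (Suc i))) \<le> q * card (W (Suc i))"
  proof (rule ccontr)
    assume neg: "\<not> ?thesis"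
    have "D * real q ^ i < card (W (Suc i))" if "i \<le> r" for i
      using that
    proof (induction i)
      case 0
      then show ?case using v by (simp add: W_def)
    next
      case (Suc i)
      then have IH: "D * real q ^ i < card (W (Suc i))" by simp
      \<comment> \<open>The induction hypothesis is strict and \<open>D\<close> is nonnegative, so
        the set is nonempty, as the negated claim requires.\<close>
      then have "0 < real (card (W (Suc i)))" using D
        by (smt (verit) mult_nonneg_nonneg of_nat_0_le_iff zero_le_power)
      then have "W (Suc i) \<noteq> {}" by auto
      then have "q * card (W (Suc i)) < card (W (Suc (Suc i)))"
        using neg Suc.prems by (auto simp: not_le Suc_le_eq)
      then have "real q * real (card (W (Suc i))) < card (W (Suc (Suc i)))"
        by (metis of_nat_less_iff of_nat_mult)
      moreover have "D * real q ^ Suc i \<le> real q * real (card (W (Suc i)))"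
        using mult_left_mono[OF less_imp_le[OF IH], of "real q"] by (simp add: mult_ac)
      ultimately show ?case by linarith
    qed
    from this[of r] show False
      using V card_mono[OF V(1) WV[of r]] by simp
  qed
  then obtain i where "i < r" "W (Suc i) \<noteq> {}" "card (W (Suc (Suc i))) \<le> q * card (W (Suc i))"
    by blast
  then show thesis using that[of "W (Suc i)"] WV indep[of "Suc i"] by (simp add: W_Suc[of "Suc i"])
qed

text \<open>Induction on the size of \<open>V\<close>: a slowly expanding set \<open>J\<close> and
  its neighbours are removed, and \<open>J\<close> is added to the class \<open>I\<close> found in
  the rest. Each vertex of \<open>J\<close> accounts for itself and \<open>q\<close> neighbours,
  hence the factor \<open>q + 1\<close>.\<close>

lemma independent_set_round:
  fixes D :: real and q :: nat
  assumes G: "simple_graph G" "family_free (short_odd_cycles r) G" and D: "0 \<le> D"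
  shows "finite V \<Longrightarrow> real (card V) \<le> D * real q ^ r \<Longrightarrow>
    \<exists>I A. I \<subseteq> V \<and> A \<subseteq> V \<and> I \<inter> A = {} \<and> I \<inter> adj G V `` I = {} \<and>
      card (V - A) \<le> (q + 1) * card I \<and> (\<forall>x\<in>A. card (adj G A `` {x}) \<le> D)"
proof (induction "card V" arbitrary: V rule: less_induct)
  case less
  show ?case
  proof (cases "\<forall>x\<in>V. card (adj G V `` {x}) \<le> D")
    case True
    then show ?thesis by (intro exI[of _ "{}"] exI[of _ V]) auto
  next
    case False
    then obtain v where "D < card (adj G V `` {v})" by (meson not_le)
    from slowly_expanding_independent_set[OF G less.prems D this]
    obtain J where J: "J \<subseteq> V" "J \<noteq> {}" "J \<inter> adj G V `` J = {}"
      "card (adj G V `` J) \<le> q * card J" by blast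
    define V' where "V' = V - (J \<union> adj G V `` J)"
    have fin: "finite J" "finite V'" using finite_subset[OF J(1)] less.prems(1) by (auto simp: V'_def)
    have lt: "card V' < card V"
      using J less.prems(1) by (intro psubset_card_mono) (auto simp: V'_def)
    then have "real (card V') \<le> D * real q ^ r" using less.prems(2) by simp
    from less.hyps[OF lt fin(2) this]
    obtain I A where IA: "I \<subseteq> V'" "A \<subseteq> V'" "I \<inter> A = {}" "I \<inter> adj G V' `` I = {}"
      "card (V' - A) \<le> (q + 1) * card I" "\<forall>x\<in>A. card (adj G A `` {x}) \<le> D" by blast
    have finI: "finite I" using IA fin finite_subset by blast
    \<comment> \<open>\<open>I\<close> lies in \<open>V'\<close>, which avoids the neighbours of
      \<open>J\<close>; symmetry of \<open>adj\<close> gives the other direction.\<close>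
    have noedge: "(x, y) \<notin> adj G V \<and> (y, x) \<notin> adj G V" if "x \<in> J" "y \<in> I" for x y
      using that IA(1) symD[OF sym_adj, of y x G V] unfolding V'_def by auto
    have restrict: "(x, y) \<in> adj G V'" if "(x, y) \<in> adj G V" "x \<in> I" "y \<in> I" for x y
      using that IA(1) by (auto simp: adj_def)
    have "(J \<union> I) \<inter> adj G V `` (J \<union> I) = {}"
      using J(3) IA(4) noedge restrict by blast
    moreover have "card (V - A) \<le> (q + 1) * card (J \<union> I)"
    proof -
      have "V - A \<subseteq> J \<union> adj G V `` J \<union> (V' - A)" by (auto simp: V'_def)
      then have "card (V - A) \<le> card (J \<union> adj G V `` J \<union> (V' - A))"
        using fin finite_adj_Image[OF less.prems(1)] by (intro card_mono) auto
      also have "\<dots> \<le> card J + card (adj G V `` J) + card (V' - A)"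
        by (meson add_le_mono1 card_Un_le le_trans)
      also have "\<dots> \<le> (q + 1) * (card J + card I)"
        using J(4) IA(5) by (simp add: algebra_simps)
      also have "card J + card I = card (J \<union> I)"
        using IA(1) fin finI by (intro card_Un_disjoint[symmetric]) (auto simp: V'_def)
      finally show ?thesis .
    qed
    moreover have "J \<union> I \<subseteq> V" "A \<subseteq> V" "(J \<union> I) \<inter> A = {}"
      using J IA by (auto simp: V'_def)
    ultimately show ?thesis using IA(6) by blast
  qed
qed

section \<open>Colourings with few monochromatic edges\<close>

definition mono_edges :: "'a ugraph \<Rightarrow> ('a \<Rightarrow> nat) \<Rightarrow> 'a set \<Rightarrow> 'a set set" where
  "mono_edges G c U = {e \<in> edges G. e \<subseteq> U \<and> (\<exists>j. \<forall>x\<in>e. c x = j)}"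

text \<open>Counting bad edges inside \<open>U\<close> alone lets parts of the graph be coloured
  separately and the costs be added. The cost is real, so averaged bounds need no rounding.\<close>

definition colorable_at_cost :: "'a ugraph \<Rightarrow> 'a set \<Rightarrow> nat \<Rightarrow> real \<Rightarrow> bool" where
  "colorable_at_cost G U k s \<longleftrightarrow> (\<exists>c. (\<forall>v\<in>U. c v < k) \<and> real (card (mono_edges G c U)) \<le> s)"

lemma mono_edgesD:
  assumes "e \<in> mono_edges G c U"
  shows "e \<in> edges G" "e \<subseteq> U" "x \<in> e \<Longrightarrow> y \<in> e \<Longrightarrow> c x = c y"
  using assms by (auto simp: mono_edges_def)

lemma mono_edgesI:
  assumes "e \<in> edges G" "e \<subseteq> U" and same: "\<And>x y. x \<in> e \<Longrightarrow> y \<in> e \<Longrightarrow> c x = c y"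
  shows "e \<in> mono_edges G c U"
proof -
  have "c x = c (SOME y. y \<in> e)" if "x \<in> e" for x
    using that someI[of "\<lambda>y. y \<in> e", OF that] by (rule same)
  then show ?thesis using assms(1,2) unfolding mono_edges_def by blast
qed

lemma finite_mono_edges: "simple_graph G \<Longrightarrow> finite (mono_edges G c U)"
  using simple_graph_edges(1)[of G] by (auto simp: mono_edges_def)

lemma colorable_at_cost_mono:
  "colorable_at_cost G U k s \<Longrightarrow> k \<le> k' \<Longrightarrow> s \<le> s' \<Longrightarrow> colorable_at_cost G U k' s'"
  unfolding colorable_at_cost_def by (meson order_trans less_le_trans)

text \<open>The two parts get disjoint palettes, so no edge between them is monochromatic. On an
  overlap the colouring of \<open>X\<close> takes precedence.\<close>

lemma colorable_at_cost_Un: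
  assumes G: "simple_graph G"
    and "colorable_at_cost G X k s" "colorable_at_cost G Y l t"
  shows "colorable_at_cost G (X \<union> Y) (k + l) (s + t)"
proof -
  obtain c d where c: "\<And>v. v \<in> X \<Longrightarrow> c v < k" "card (mono_edges G c X) \<le> s"
    and d: "\<And>v. v \<in> Y \<Longrightarrow> d v < l" "card (mono_edges G d Y) \<le> t"
    using assms by (auto simp: colorable_at_cost_def)
  define b where "b v = (if v \<in> X then c v else k + d v)" for v
  have "e \<in> mono_edges G c X \<union> mono_edges G d Y" if e: "e \<in> mono_edges G b (X \<union> Y)" for e
  proof (cases "e \<inter> X = {}")
    case True
    then have eq: "b x = k + d x" if "x \<in> e" for x
      using that by (auto simp: b_def)
    have sub: "e \<subseteq> Y" using mono_edgesD(2)[OF e] True by blast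
    have "d x = d y" if "x \<in> e" "y \<in> e" for x y
      using mono_edgesD(3)[OF e that] eq[OF that(1)] eq[OF that(2)] by simp
    then have "e \<in> mono_edges G d Y"
      by (rule mono_edgesI[OF mono_edgesD(1)[OF e] sub])
    then show ?thesis ..
  next
    case False
    then obtain x where x: "x \<in> e" "x \<in> X" by blast
    have eq: "b y = c x" if "y \<in> e" for y
      using mono_edgesD(3)[OF e that x(1)] x(2) by (simp add: b_def)
    \<comment> \<open>A colour \<open>c x < k\<close> cannot equal a shifted colour
      \<open>k + d y\<close>, so an edge with one end in \<open>X\<close> has both ends
      there.\<close>
    have same: "y \<in> X \<and> c y = c x" if "y \<in> e" for y
      using c(1)[OF x(2)] eq[OF that] by (auto simp: b_def split: if_splits)
    have sub: "e \<subseteq> X" using same by blast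
    have "c y = c z" if "y \<in> e" "z \<in> e" for y z
      using same[OF that(1)] same[OF that(2)] by simp
    then have "e \<in> mono_edges G c X"
      by (rule mono_edgesI[OF mono_edgesD(1)[OF e] sub])
    then show ?thesis ..
  qed
  then have "card (mono_edges G b (X \<union> Y)) \<le> card (mono_edges G c X \<union> mono_edges G d Y)"
    using G by (intro card_mono) (auto simp: finite_mono_edges)
  also have "\<dots> \<le> card (mono_edges G c X) + card (mono_edges G d Y)" by (rule card_Un_le)
  finally have "card (mono_edges G b (X \<union> Y)) \<le> s + t" using c(2) d(2) by linarith
  moreover have "b v < k + l" if "v \<in> X \<union> Y" for v
    using that c(1) d(1) by (auto simp: b_def trans_less_add1)
  ultimately show ?thesis unfolding colorable_at_cost_def by blast
qed

lemma colorable_at_cost_independent: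
  assumes G: "simple_graph G" and I: "I \<subseteq> V" "I \<inter> adj G V `` I = {}"
  shows "colorable_at_cost G I 1 0"
proof -
  have "e \<notin> mono_edges G (\<lambda>_. 0) I" for e
  proof
    assume e: "e \<in> mono_edges G (\<lambda>_. 0) I"
    then have "card e = 2" using G by (auto simp: simple_graph_def mono_edges_def)
    then obtain x y where "e = {x, y}" by (auto simp: card_2_iff)
    then have "x \<in> I" "y \<in> I" "(x, y) \<in> adj G V" using e I(1) by (auto simp: mono_edges_def adj_def)
    then show False using I(2) by blast
  qed
  then have "mono_edges G (\<lambda>_. 0) I = {}" by blast
  then show ?thesis by (auto simp: colorable_at_cost_def intro!: exI[of _ "\<lambda>_. 0"])
qed

lemma colorable_at_cost_empty: "simple_graph G \<Longrightarrow> colorable_at_cost G {} 0 0"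
  using simple_graph_edges(1)[of G]
  by (auto simp: colorable_at_cost_def mono_edges_def simple_graph_def)

lemma colorable_at_cost_trivial:
  assumes G: "simple_graph G" and U: "finite U" and k: "1 \<le> k"
  shows "colorable_at_cost G U k ((real (card U))\<^sup>2)"
proof -
  have "e \<in> (\<lambda>(x, y). {x, y}) ` (U \<times> U)" if "e \<in> mono_edges G (\<lambda>_. 0) U" for e
  proof -
    have "card e = 2" using that G by (auto simp: simple_graph_def mono_edges_def)
    then obtain x y where "e = {x, y}" by (auto simp: card_2_iff)
    then show ?thesis using that by (auto simp: mono_edges_def)
  qed
  then have "card (mono_edges G (\<lambda>_. 0) U) \<le> card (U \<times> U)"
    using U by (intro surj_card_le[where f = "\<lambda>(x, y). {x, y}"]) auto
  then have "real (card (mono_edges G (\<lambda>_. 0) U)) \<le> (real (card U))\<^sup>2"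
    by (metis card_cartesian_product of_nat_le_iff of_nat_power power2_eq_square)
  then show ?thesis using k by (auto simp: colorable_at_cost_def intro!: exI[of _ "\<lambda>_. 0"])
qed

text \<open>By averaging: otherwise the \<open>a\<close> classes together would have more than
  \<open>card N\<close> elements.\<close>

lemma exists_rare_colour:
  fixes c :: "'a \<Rightarrow> nat"
  assumes "finite N" "1 \<le> a" "\<forall>v\<in>N. c v < a"
  shows "\<exists>j<a. a * card {v \<in> N. c v = j} \<le> card N"
proof (rule ccontr)
  assume "\<not> ?thesis"
  then have gt: "card N < a * card {v \<in> N. c v = j}" if "j < a" for j using that by (auto simp: not_le)
  have "card N = card (\<Union>j<a. {v \<in> N. c v = j})"
    using assms(3) by (intro arg_cong[where f = card]) auto
  also have "\<dots> = (\<Sum>j<a. card {v \<in> N. c v = j})"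
    using assms(1) by (intro card_UN_disjoint) auto
  finally have "a * card N = (\<Sum>j<a. a * card {v \<in> N. c v = j})" by (simp add: sum_distrib_left)
  moreover have "(\<Sum>j<a. card N) < (\<Sum>j<a. a * card {v \<in> N. c v = j})"
    using assms(2) gt by (intro sum_strict_mono) (auto simp: lessThan_empty_iff)
  ultimately show False by simp
qed

text \<open>Greedy colouring: a new vertex has at most \<open>D\<close> coloured neighbours, and the
  rarest of the \<open>a\<close> colours among them creates at most \<open>D / a\<close> new
  monochromatic edges.\<close>

lemma colorable_at_cost_bounded_degree:
  fixes D :: real
  assumes G: "simple_graph G" and a: "1 \<le> a"
  shows "finite A \<Longrightarrow> (\<forall>x\<in>A. card (adj G A `` {x}) \<le> D) \<Longrightarrow>
    colorable_at_cost G A a (card A * D / a)"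
proof (induction A rule: finite_induct)
  case empty
  then show ?case using colorable_at_cost_mono[OF colorable_at_cost_empty[OF G]] by simp
next
  case (insert v A)
  have "real (card (adj G A `` {x})) \<le> D" if "x \<in> A" for x
  proof -
    have "card (adj G A `` {x}) \<le> card (adj G (insert v A) `` {x})"
      using insert.hyps by (intro card_mono finite_adj_Image) (auto simp: adj_def)
    then show ?thesis using insert.prems that by (meson insertCI le_trans of_nat_le_iff order_trans)
  qed
  with insert.IH obtain c where c: "\<forall>x\<in>A. c x < a" "card (mono_edges G c A) \<le> card A * D / a"
    by (auto simp: colorable_at_cost_def)
  define N where "N = {x \<in> A. {v, x} \<in> edges G}"
  have "finite N" using insert.hyps by (auto simp: N_def)
  then obtain j where j: "j < a" "a * card {x \<in> N. c x = j} \<le> card N"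
    using exists_rare_colour[of N a c] a c(1) by (auto simp: N_def)
  have "card N \<le> card (adj G (insert v A) `` {v})"
    using insert.hyps by (intro card_mono finite_adj_Image) (auto simp: adj_def N_def)
  then have "real (card N) \<le> D" using insert.prems by (meson insertI1 of_nat_le_iff order_trans)
  then have "real (a * card {x \<in> N. c x = j}) \<le> D" using j(2) by linarith
  then have deg: "card {x \<in> N. c x = j} \<le> D / a" using a by (simp add: field_simps)
  define b where "b = c(v := j)"
  \<comment> \<open>Recolouring \<open>v\<close> alone can only spoil edges from \<open>v\<close> to
    neighbours of colour \<open>j\<close>.\<close>
  have sub: "mono_edges G b (insert v A) \<subseteq> mono_edges G c A \<union> (\<lambda>x. {v, x}) ` {x \<in> N. c x = j}"
  proof
    fix e assume e: "e \<in> mono_edges G b (insert v A)"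
    show "e \<in> mono_edges G c A \<union> (\<lambda>x. {v, x}) ` {x \<in> N. c x = j}"
    proof (cases "v \<in> e")
      case True
      have "card e = 2" using e G by (auto simp: simple_graph_def mono_edges_def)
      then obtain x where x: "e = {v, x}" "x \<noteq> v" using True by (auto simp: card_2_iff)
      have "x \<in> N"
        using mono_edgesD(1,2)[OF e] x by (auto simp: N_def)
      moreover have "c x = j"
        using mono_edgesD(3)[OF e, of x v] x by (simp add: b_def)
      ultimately show ?thesis using x by blast
    next
      case False
      then have eq: "b x = c x" if "x \<in> e" for x using that by (auto simp: b_def)
      have eA: "e \<subseteq> A" using mono_edgesD(2)[OF e] False by blast
      have "c x = c y" if "x \<in> e" "y \<in> e" for x y
        using mono_edgesD(3)[OF e that] eq[OF that(1)] eq[OF that(2)] by simp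
      then have "e \<in> mono_edges G c A"
        by (rule mono_edgesI[OF mono_edgesD(1)[OF e] eA])
      then show ?thesis ..
    qed
  qed
  have "card (mono_edges G b (insert v A))
      \<le> card (mono_edges G c A \<union> (\<lambda>x. {v, x}) ` {x \<in> N. c x = j})"
    using \<open>finite N\<close> finite_mono_edges[OF G] by (intro card_mono[OF _ sub]) auto
  also have "\<dots> \<le> card (mono_edges G c A) + card {x \<in> N. c x = j}"
    using \<open>finite N\<close> by (intro order_trans[OF card_Un_le] add_left_mono card_image_le) simp
  finally have "real (card (mono_edges G b (insert v A))) \<le> card A * D / a + D / a"
    using c(2) deg by linarith
  also have "\<dots> = card (insert v A) * D / a"
    using insert.hyps by (simp add: distrib_right add_divide_distrib)
  finally show ?case
    unfolding colorable_at_cost_def using c(1) j(1) by (auto simp: b_def intro!: exI[of _ b])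
qed

section \<open>Halving the uncoloured set and recursing\<close>

text \<open>Each round spends one colour on a new independent class. Until a low-degree set
  \<open>A\<close> covers all but \<open>card U / 2\<close> of the remaining vertices, each class
  has at least \<open>card U / (2 * (q + 1))\<close> elements.\<close>

lemma independent_set_rounds:
  fixes D :: real and q t :: nat
  assumes G: "simple_graph G" "family_free (short_odd_cycles r) G" and D: "0 \<le> D"
    and U: "finite U" "real (card U) \<le> D * real q ^ r"
  shows "\<exists>V\<subseteq>U. colorable_at_cost G (U - V) t 0 \<and>
    ((\<exists>A\<subseteq>V. (\<forall>x\<in>A. card (adj G A `` {x}) \<le> D) \<and> 2 * card (V - A) \<le> card U) \<or>
     t * card U \<le> 2 * (q + 1) * card (U - V))"
proof (induction t)
  case 0
  then show ?case using colorable_at_cost_empty[OF G(1)] by (intro exI[of _ U]) auto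
next
  case (Suc t)
  then obtain V where V: "V \<subseteq> U" "colorable_at_cost G (U - V) t 0" and
    alt: "(\<exists>A\<subseteq>V. (\<forall>x\<in>A. card (adj G A `` {x}) \<le> D) \<and> 2 * card (V - A) \<le> card U) \<or>
     t * card U \<le> 2 * (q + 1) * card (U - V)" by blast
  have V': "colorable_at_cost G (U - V) (Suc t) 0" using colorable_at_cost_mono[OF V(2)] by simp
  have fin: "finite V" using V U finite_subset by blast
  have "card V \<le> card U" using V(1) U(1) by (simp add: card_mono)
  then have "real (card V) \<le> D * real q ^ r" using U(2) by simp
  from independent_set_round[OF G D fin this]
  obtain I A where IA: "I \<subseteq> V" "A \<subseteq> V" "I \<inter> A = {}" "I \<inter> adj G V `` I = {}"
    "card (V - A) \<le> (q + 1) * card I" "\<forall>x\<in>A. card (adj G A `` {x}) \<le> D" by blast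
  show ?case
  proof (cases "(\<exists>A\<subseteq>V. (\<forall>x\<in>A. card (adj G A `` {x}) \<le> D) \<and> 2 * card (V - A) \<le> card U)")
    case True
    then show ?thesis using V(1) V' by blast
  next
    case False
    then have t: "t * card U \<le> 2 * (q + 1) * card (U - V)" using alt by blast
    \<comment> \<open>The set \<open>A\<close> of this round would otherwise satisfy the first
      alternative; the bound on \<open>V - A\<close> then makes \<open>I\<close> large.\<close>
    have "card U < 2 * card (V - A)" using False IA(2,6) by (meson not_le)
    then have I: "card U \<le> 2 * (q + 1) * card I" using IA(5) by simp
    have eq: "U - (V - I) = (U - V) \<union> I" using V(1) IA(1) by blast
    have "card (U - (V - I)) = card (U - V) + card I"
      unfolding eq using U(1) fin IA(1) by (intro card_Un_disjoint) (auto intro: finite_subset)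
    then have "Suc t * card U \<le> 2 * (q + 1) * card (U - (V - I))"
      using t I by (simp add: algebra_simps)
    moreover have "colorable_at_cost G (U - (V - I)) (Suc t) 0"
      using colorable_at_cost_Un[OF G(1) V(2) colorable_at_cost_independent[OF G(1) IA(1,4)]]
      unfolding eq by simp
    ultimately show ?thesis using V(1) by blast
  qed
qed

text \<open>The rounds are run with \<open>q = a\<close> and \<open>t = 2 * (a + 1)\<close>. Greedy
  colouring of \<open>A\<close> with \<open>a\<close> further colours costs at most
  \<open>card U * D / a\<close>, and \<open>X\<close> is what remains outside
  \<open>A\<close>.\<close>

lemma halving_step:
  assumes G: "simple_graph G" "family_free (short_odd_cycles r) G"
    and U: "finite U" and a: "1 \<le> a"
  obtains X where "X \<subseteq> U" "2 * card X \<le> card U"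
    "colorable_at_cost G (U - X) (2 * (a + 1) + a) ((real (card U))\<^sup>2 / real a ^ (r + 1))"
proof -
  define D where "D = real (card U) / real a ^ r"
  have D: "0 \<le> D" "real (card U) \<le> D * real a ^ r" using a by (auto simp: D_def)
  obtain V where V: "V \<subseteq> U" "colorable_at_cost G (U - V) (2 * (a + 1)) 0" and
    alt: "(\<exists>A\<subseteq>V. (\<forall>x\<in>A. card (adj G A `` {x}) \<le> D) \<and> 2 * card (V - A) \<le> card U) \<or>
     2 * (a + 1) * card U \<le> 2 * (a + 1) * card (U - V)"
    using independent_set_rounds[OF G D(1) U D(2), of "2 * (a + 1)"] by blast
  have fin: "finite V" using V U finite_subset by blast
  have "\<exists>A\<subseteq>V. (\<forall>x\<in>A. card (adj G A `` {x}) \<le> D) \<and> 2 * card (V - A) \<le> card U"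
  proof (rule ccontr)
    assume neg: "\<not> ?thesis"
    then have "2 * (a + 1) * card U \<le> 2 * (a + 1) * card (U - V)" using alt by blast
    \<comment> \<open>With this number of rounds the second alternative means that everything is
      coloured. Then \<open>V\<close> is empty, and the empty set serves as \<open>A\<close> in the
      first alternative.\<close>
    then have "card U \<le> card (U - V)" by (subst (asm) mult_le_cancel1) simp
    then have "V = {}"
      using V(1) U by (metis Diff_subset card_seteq double_diff Diff_cancel order_refl)
    then show False using neg by auto
  qed
  then obtain A where A: "A \<subseteq> V" "\<forall>x\<in>A. card (adj G A `` {x}) \<le> D" "2 * card (V - A) \<le> card U"
    by blast
  have finA: "finite A" using A fin finite_subset by blast
  have "card A \<le> card U" using A(1) V(1) U by (intro card_mono) auto
  then have "card A * D / a \<le> card U * D / a"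
    using D(1) by (intro divide_right_mono mult_right_mono) auto
  also have "\<dots> = (real (card U))\<^sup>2 / real a ^ (r + 1)"
    using a by (simp add: D_def power2_eq_square field_simps)
  finally have "colorable_at_cost G A a ((real (card U))\<^sup>2 / real a ^ (r + 1))"
    using colorable_at_cost_mono[OF colorable_at_cost_bounded_degree[OF G(1) a finA A(2)] order_refl]
    by blast
  moreover have "U - (V - A) = (U - V) \<union> A" using A(1) V(1) by blast
  ultimately have "colorable_at_cost G (U - (V - A)) (2 * (a + 1) + a) ((real (card U))\<^sup>2 / real a ^ (r + 1))"
    using colorable_at_cost_Un[OF G(1) V(2)] by fastforce
  then show thesis using that[of "V - A"] A(3) V(1) by blast
qed

text \<open>Half of the bound pays for a halving step and the other half for the recursive call:
  \<open>X\<close> has at most half the vertices, which divides the square by 4, while the loss of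
  colours costs at most a factor 2.\<close>

lemma colorable_at_cost_quadratic:
  fixes r k :: nat
  defines "C \<equiv> 2 * (20 * (real r + 1)) ^ (r + 1)"
  assumes G: "simple_graph G" "family_free (short_odd_cycles r) G"
  shows "finite U \<Longrightarrow> 1 \<le> k \<Longrightarrow>
    colorable_at_cost G U k (C * (real (card U))\<^sup>2 / real k ^ (r + 1))"
proof (induction k arbitrary: U rule: less_induct)
  case (less k)
  define u where "u = (real (card U))\<^sup>2"
  \<comment> \<open>A halving step with \<open>a = k div N\<close> uses at most \<open>5 a\<close> colours. This leaves a fraction of at least
    \<open>1 - 1 / (2 (r + 1))\<close> of them, and by Bernoulli its power \<open>r + 1\<close> is at least \<open>1 / 2\<close>.\<close>
  define N where "N = 10 * (r + 1)"
  have u: "0 \<le> u" by (simp add: u_def)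
  have kpos: "0 < real k ^ (r + 1)" using less.prems by simp
  show ?case
  proof (cases "k < N")
    case True
    \<comment> \<open>For \<open>k < N\<close> the quotient \<open>k div N\<close> is 0 and no
      halving step is possible, but \<open>C\<close> is large enough for a constant
      colouring.\<close>
    have "real k ^ (r + 1) \<le> (20 * (real r + 1)) ^ (r + 1)"
      using True by (intro power_mono) (auto simp: N_def)
    also have "\<dots> \<le> C" by (simp add: C_def)
    finally have "u \<le> C * u / real k ^ (r + 1)"
      using kpos mult_right_mono[OF _ u, of "real k ^ (r + 1)" C]
      by (simp add: pos_le_divide_eq mult.commute del: power_Suc)
    then show ?thesis
      using colorable_at_cost_mono[OF colorable_at_cost_trivial[OF G(1) less.prems] order_refl]
      by (simp add: u_def)
  next
    case False
    define a where "a = k div N"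
    have Npos: "0 < N" by (simp add: N_def)
    then have a1: "1 \<le> a" using False div_le_mono[of N k N] by (simp add: a_def)
    have aN: "a * N \<le> k" by (simp add: a_def)
    \<comment> \<open>Rounding down loses less than a factor 2, as \<open>a\<close> is at least 1.
      This turns the 10 in \<open>N\<close> into the 20 in \<open>C\<close>.\<close>
    have "k < a * N + N"
      unfolding a_def using Npos by (metis add.commute dividend_less_div_times mult.commute)
    also have "\<dots> \<le> 2 * N * a" using a1 by (simp add: algebra_simps)
    finally have "real k \<le> real (2 * N * a)" by linarith
    then have ka: "real k \<le> 20 * (real r + 1) * real a" by (simp add: N_def algebra_simps)
    define k' where "k' = k - (2 * (a + 1) + a)"
    have "5 * a \<le> a * N" by (simp add: N_def)
    then have "5 * a \<le> k" using aN by (rule order_trans)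
    then have kk: "2 * (a + 1) + a \<le> 5 * a" "5 * a \<le> k" "2 * (a + 1) + a + k' = k"
      using a1 by (auto simp: k'_def)
    have "real a * (10 * (real r + 1)) \<le> real k"
      using aN unfolding N_def by (simp flip: of_nat_le_iff[where 'a = real] add: algebra_simps)
    then have "5 * real a \<le> real k / (2 * (real r + 1))" by (simp add: field_simps)
    moreover have "real k - 5 * real a \<le> real k'" using kk by linarith
    ultimately have k'k: "real k * (1 - 1 / (2 * (real r + 1))) \<le> real k'"
      by (simp add: algebra_simps)
    have frac: "0 < 1 - 1 / (2 * (real r + 1))" by (simp add: field_simps)
    have k'1: "1 \<le> k'"
    proof -
      have "0 < real k * (1 - 1 / (2 * (real r + 1)))"
        using frac less.prems(2) by (intro mult_pos_pos) auto
      then have "0 < real k'" using k'k by linarith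
      then show ?thesis by simp
    qed
    have k'lt: "k' < k" using kk(3) by simp
    have "1 + real (r + 1) * (- (1 / (2 * (real r + 1)))) \<le> (1 + (- (1 / (2 * (real r + 1))))) ^ (r + 1)"
      by (rule Bernoulli_inequality) (simp add: field_simps)
    moreover have "1 + real (r + 1) * (- (1 / (2 * (real r + 1)))) = 1 / 2"
      by (simp add: field_simps)
    ultimately have "1 / 2 \<le> (1 - 1 / (2 * (real r + 1))) ^ (r + 1)"
      by (simp only: add_uminus_conv_diff)
    then have "real k ^ (r + 1) * (1 / 2) \<le> real k ^ (r + 1) * (1 - 1 / (2 * (real r + 1))) ^ (r + 1)"
      by (intro mult_left_mono) auto
    also have "\<dots> = (real k * (1 - 1 / (2 * (real r + 1)))) ^ (r + 1)" by (rule power_mult_distrib[symmetric])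
    also have "\<dots> \<le> real k' ^ (r + 1)"
      using k'k frac by (intro power_mono) auto
    finally have pow: "real k ^ (r + 1) / 2 \<le> real k' ^ (r + 1)" by simp
    obtain X where X: "X \<subseteq> U" "2 * card X \<le> card U"
      "colorable_at_cost G (U - X) (2 * (a + 1) + a) (u / real a ^ (r + 1))"
      using halving_step[OF G less.prems(1) a1] unfolding u_def by blast
    have "finite X" using X less.prems finite_subset by blast
    from colorable_at_cost_Un[OF G(1) X(3) less.IH[OF k'lt this k'1]]
    have col: "colorable_at_cost G U k
        (u / real a ^ (r + 1) + C * (real (card X))\<^sup>2 / real k' ^ (r + 1))"
      using X(1) unfolding kk(3) by (simp add: Un_absorb2)
    have apos: "0 < real a ^ (r + 1)" using a1 by simp
    have C0: "0 \<le> C" by (simp add: C_def)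
    \<comment> \<open>First half: the cost of the halving step.\<close>
    have "real k ^ (r + 1) \<le> (20 * (real r + 1) * real a) ^ (r + 1)" using ka by (intro power_mono) auto
    also have "\<dots> = C / 2 * real a ^ (r + 1)" by (simp add: power_mult_distrib C_def del: power_Suc)
    finally have "u * real k ^ (r + 1) \<le> u * (C / 2 * real a ^ (r + 1))" using u by (rule mult_left_mono)
    then have p1: "u / real a ^ (r + 1) \<le> C / 2 * u / real k ^ (r + 1)"
      using kpos apos by (simp add: pos_le_divide_eq pos_divide_le_eq mult_ac del: power_Suc)
    \<comment> \<open>Second half: the cost of the recursive call on \<open>X\<close> with
      \<open>k'\<close> colours.\<close>
    have "(2 * real (card X))\<^sup>2 \<le> u"
      unfolding u_def using X(2) by (intro power_mono) auto
    then have "C * (real (card X))\<^sup>2 \<le> C * (u / 4)"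
      using C0 by (intro mult_left_mono) (auto simp: power_mult_distrib)
    then have "C * (real (card X))\<^sup>2 / real k' ^ (r + 1) \<le> C * (u / 4) / (real k ^ (r + 1) / 2)"
      using pow kpos u C0 by (intro frac_le) auto
    also have "\<dots> = C / 2 * u / real k ^ (r + 1)" by simp
    finally have "u / real a ^ (r + 1) + C * (real (card X))\<^sup>2 / real k' ^ (r + 1)
        \<le> C / 2 * u / real k ^ (r + 1) + C / 2 * u / real k ^ (r + 1)"
      using p1 by linarith
    also have "\<dots> = C * u / real k ^ (r + 1)" by (simp add: field_simps)
    finally show ?thesis
      using colorable_at_cost_mono[OF col order_refl] by (simp add: u_def)
  qed
qed

section \<open>From colourings back to edge deletion\<close>

text \<open>Deleting the monochromatic edges makes the colouring proper, so their number is a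
  candidate for the minimum.\<close>

lemma h_graph_le_cost:
  assumes G: "simple_graph G" and k: "1 \<le> k" and col: "colorable_at_cost G (verts G) k s"
  shows "real (h_graph G k) \<le> s"
proof -
  obtain c where c: "\<forall>v\<in>verts G. c v < k" "card (mono_edges G c (verts G)) \<le> s"
    using col by (auto simp: colorable_at_cost_def)
  let ?F = "mono_edges G c (verts G)"
  have sub: "\<And>e. e \<in> edges G \<Longrightarrow> e \<subseteq> verts G" using G by (auto simp: simple_graph_def)
  have "c u \<noteq> c v" if "{u, v} \<in> edges (delete_edges G ?F)" for u v
    using that sub[of "{u, v}"] by (auto simp: delete_edges_def mono_edges_def)
  then have "colorable k (delete_edges G ?F)"
    using c(1) by (auto simp: colorable_def delete_edges_def)
  moreover have "?F \<subseteq> edges G" by (auto simp: mono_edges_def)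
  ultimately have "h_graph G k \<le> card ?F"
    unfolding h_graph_def using h_graph_set(1)[OF G k] by (intro Min_le) auto
  then show ?thesis using c(2) by linarith
qed

theorem theorem1p2:
  fixes r :: nat
  assumes "r \<ge> 1"
  shows "\<exists>c :: real. \<forall>n k :: nat. n \<ge> 1 \<longrightarrow> k \<ge> 1 \<longrightarrow>
           real (h_family n k (short_odd_cycles r)) < c * real n ^ 2 / real k ^ (r + 1)"
proof (intro exI allI impI)
  fix n k :: nat
  assume n: "1 \<le> n" and k: "1 \<le> k"
  let ?C = "2 * (20 * (real r + 1)) ^ (r + 1)"
  have "h_family n k (short_odd_cycles r) \<in> {h_graph G k | G :: nat ugraph.
      simple_graph G \<and> card (verts G) = n \<and> family_free (short_odd_cycles r) G}"
    unfolding h_family_def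
    by (rule Max_in[OF h_family_set_finite[OF k] h_family_set_nonempty])
  then obtain G :: "nat ugraph" where G: "simple_graph G" "card (verts G) = n"
      "family_free (short_odd_cycles r) G"
    and h: "h_family n k (short_odd_cycles r) = h_graph G k" by blast
  have "finite (verts G)" using G(1) by (simp add: simple_graph_def)
  then have "real (h_graph G k) \<le> ?C * (real n)\<^sup>2 / real k ^ (r + 1)"
    using h_graph_le_cost[OF G(1) k colorable_at_cost_quadratic[OF G(1,3) _ k]] G(2) by simp
  \<comment> \<open>Adding 1 to the constant makes the inequality strict, since \<open>n\<close> is
    positive.\<close>
  also have "\<dots> < (?C + 1) * real n ^ 2 / real k ^ (r + 1)"
    using n k by (intro divide_strict_right_mono mult_strict_right_mono) auto
  finally show "real (h_family n k (short_odd_cycles r)) < (?C + 1) * real n ^ 2 / real k ^ (r + 1)"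
    using h by simp
qed

end
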